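(* If a separately continuous (linear) action of a compact group $\mathrm{G}$ on a locally convex space $E$ has finitely many isotypic components, then the dual action of $\mathrm{G}$ on the weak dual $E'$ is jointly continuous.
   Context: Locally convex topological vector spaces (complex) and compact groups are assumed Hausdorff. An action $\mathrm{G}\times E\to E$ by linear maps is separately continuous if it is continuous in each variable when the other is fixed, and jointly continuous if it is continuous on the product $\mathrm{G}\times E$. For an irreducible (finite-dimensional, continuous) representation $\rho$ of $\mathrm{G}$, the $\rho$-isotypic component $E_\rho$ is the largest $\mathrm{G}$-invariant subspace of $E$ decomposing as a sum of copies of $\rho$. The action has finitely many isotypic components if $E$ is the sum of finitely many subspaces $E_\rho$. The weak dual $E'$ is the space of continuous linear functionals on $E$ with the topology of pointwise convergence on $E$; the dual action is $(g\cdot f)(x)=f(g^{-1}x)$. *)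

theory Defs
  imports "HOL-Analysis.Analysis" "Jordan_Normal_Form.Matrix"
begin

text \<open>
  A topological group is a type of class \<open>topological_group_add\<close>. That class does not assume
  commutativity, so this covers every topological group, written additively: \<open>g + h\<close> is the
  product, \<open>0\<close> the unit and \<open>- g\<close> the inverse.
\<close>

locale locally_convex_space = vector_space smul
  for smul :: "complex \<Rightarrow> 'e \<Rightarrow> 'e::{topological_ab_group_add, t2_space}" +
  assumes continuous_scale: "continuous_on UNIV (\<lambda>(c, x). smul c x)"
    and locally_convex: "open U \<Longrightarrow> 0 \<in> U \<Longrightarrow>
      \<exists>V. open V \<and> 0 \<in> V \<and> V \<subseteq> U \<and>
        (\<forall>x\<in>V. \<forall>y\<in>V. \<forall>u\<ge>0. \<forall>v\<ge>0. u + v = 1 \<longrightarrow>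
          smul (complex_of_real u) x + smul (complex_of_real v) y \<in> V)"

definition linear_action ::
    "(complex \<Rightarrow> 'e \<Rightarrow> 'e::ab_group_add) \<Rightarrow> ('g::group_add \<Rightarrow> 'e \<Rightarrow> 'e) \<Rightarrow> bool" where
  "linear_action smul act \<longleftrightarrow>
     (\<forall>g. Vector_Spaces.linear smul smul (act g)) \<and>
     (\<forall>x. act 0 x = x) \<and>
     (\<forall>g h x. act (g + h) x = act g (act h x))"

definition separately_continuous ::
    "('g::topological_space \<Rightarrow> 'e::topological_space \<Rightarrow> 'e) \<Rightarrow> bool" where
  "separately_continuous act \<longleftrightarrow>
     (\<forall>g. continuous_on UNIV (act g)) \<and> (\<forall>x. continuous_on UNIV (\<lambda>g. act g x))"

definition jointly_continuous ::
    "'g topology \<Rightarrow> 'x topology \<Rightarrow> ('g \<Rightarrow> 'x \<Rightarrow> 'x) \<Rightarrow> bool" where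
  "jointly_continuous S X act \<longleftrightarrow> continuous_map (prod_topology S X) X (\<lambda>(g, x). act g x)"

text \<open>
  After a choice of basis, a finite-dimensional representation is a homomorphism into the
  invertible matrices of some size \<open>n\<close>; the representation space is \<open>carrier_vec n\<close>.
  Invertibility of \<open>\<rho> g\<close> follows from the homomorphism property and \<open>\<rho> 0 = 1\<^sub>m n\<close>.
\<close>

definition representation :: "nat \<Rightarrow> ('g::{topological_space, group_add} \<Rightarrow> complex mat) \<Rightarrow> bool" where
  "representation n \<rho> \<longleftrightarrow>
     (\<forall>g. \<rho> g \<in> carrier_mat n n) \<and>
     \<rho> 0 = 1\<^sub>m n \<and>
     (\<forall>g h. \<rho> (g + h) = \<rho> g * \<rho> h) \<and>
     (\<forall>i<n. \<forall>j<n. continuous_on UNIV (\<lambda>g. \<rho> g $$ (i, j)))"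

definition vec_subspace :: "nat \<Rightarrow> complex Matrix.vec set \<Rightarrow> bool" where
  "vec_subspace n W \<longleftrightarrow>
     W \<subseteq> carrier_vec n \<and> 0\<^sub>v n \<in> W \<and>
     (\<forall>v\<in>W. \<forall>w\<in>W. v + w \<in> W) \<and> (\<forall>c. \<forall>v\<in>W. c \<cdot>\<^sub>v v \<in> W)"

definition irreducible_representation ::
    "nat \<Rightarrow> ('g::{topological_space, group_add} \<Rightarrow> complex mat) \<Rightarrow> bool" where
  "irreducible_representation n \<rho> \<longleftrightarrow>
     representation n \<rho> \<and> n > 0 \<and>
     (\<forall>W. vec_subspace n W \<and> (\<forall>g. \<forall>v\<in>W. \<rho> g *\<^sub>v v \<in> W) \<longrightarrow> W = {0\<^sub>v n} \<or> W = carrier_vec n)"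

text \<open>
  \<open>V\<close> is a copy of \<open>\<rho>\<close> if it is the image of the representation space under an injective
  equivariant linear map. The map need not be assumed continuous: its domain is
  finite-dimensional.
\<close>

definition is_copy ::
    "(complex \<Rightarrow> 'e \<Rightarrow> 'e::ab_group_add) \<Rightarrow> ('g \<Rightarrow> 'e \<Rightarrow> 'e) \<Rightarrow>
      nat \<Rightarrow> ('g \<Rightarrow> complex mat) \<Rightarrow> 'e set \<Rightarrow> bool" where
  "is_copy smul act n \<rho> V \<longleftrightarrow>
     (\<exists>T. bij_betw T (carrier_vec n) V \<and>
       (\<forall>v\<in>carrier_vec n. \<forall>w\<in>carrier_vec n. T (v + w) = T v + T w) \<and>
       (\<forall>c. \<forall>v\<in>carrier_vec n. T (c \<cdot>\<^sub>v v) = smul c (T v)) \<and>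
       (\<forall>g. \<forall>v\<in>carrier_vec n. T (\<rho> g *\<^sub>v v) = act g (T v)))"

definition sum_of_copies ::
    "(complex \<Rightarrow> 'e \<Rightarrow> 'e::ab_group_add) \<Rightarrow> ('g \<Rightarrow> 'e \<Rightarrow> 'e) \<Rightarrow>
      nat \<Rightarrow> ('g \<Rightarrow> complex mat) \<Rightarrow> 'e set \<Rightarrow> bool" where
  "sum_of_copies smul act n \<rho> W \<longleftrightarrow>
     (\<exists>\<V>. (\<forall>V\<in>\<V>. is_copy smul act n \<rho> V) \<and> W = module.span smul (\<Union>\<V>))"

definition isotypic_component ::
    "(complex \<Rightarrow> 'e \<Rightarrow> 'e::ab_group_add) \<Rightarrow> ('g \<Rightarrow> 'e \<Rightarrow> 'e) \<Rightarrow>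
      nat \<Rightarrow> ('g \<Rightarrow> complex mat) \<Rightarrow> 'e set" where
  "isotypic_component smul act n \<rho> =
     (GREATEST W. module.subspace smul W \<and> (\<forall>g. \<forall>x\<in>W. act g x \<in> W) \<and>
        sum_of_copies smul act n \<rho> W)"

text \<open>The greatest element in the previous definition exists: it is the span of all copies.\<close>

lemma isotypic_component_eq_span:
  assumes "vector_space smul"
    and lin: "linear_action smul act"
    and car: "\<And>g. \<rho> g \<in> carrier_mat n n"
  shows "isotypic_component smul act n \<rho> =
    module.span smul (\<Union>{V. is_copy smul act n \<rho> V})"
proof -
  interpret vector_space smul by fact
  let ?C = "\<Union>{V. is_copy smul act n \<rho> V}"
  have copy_inv: "act g x \<in> V" if cp: "is_copy smul act n \<rho> V" and x: "x \<in> V" for g x V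
  proof -
    obtain T where T: "bij_betw T (carrier_vec n) V"
      "\<forall>g. \<forall>v\<in>carrier_vec n. T (\<rho> g *\<^sub>v v) = act g (T v)"
      using cp unfolding is_copy_def by blast
    obtain v where v: "v \<in> carrier_vec n" "x = T v"
      using T(1) x by (auto simp: bij_betw_def)
    have "\<rho> g *\<^sub>v v \<in> carrier_vec n"
      using car[of g] v(1) by (rule mult_mat_vec_carrier)
    then have "T (\<rho> g *\<^sub>v v) \<in> V"
      using bij_betwE[OF T(1)] by blast
    then show ?thesis using T(2) v by auto
  qed
  have inv: "act g x \<in> span ?C" if "x \<in> span ?C" for g x
  proof -
    interpret L: Vector_Spaces.linear smul smul "act g"
      using lin unfolding linear_action_def by blast
    have "act g x \<in> act g ` span ?C" using that by blast
    also have "act g ` span ?C = span (act g ` ?C)" by (simp add: L.span_image)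
    also have "\<dots> \<subseteq> span ?C" by (rule span_mono) (auto intro: copy_inv)
    finally show ?thesis .
  qed
  show ?thesis
    unfolding isotypic_component_def
  proof (rule Greatest_equality)
    show "subspace (span ?C) \<and> (\<forall>g. \<forall>x\<in>span ?C. act g x \<in> span ?C) \<and>
        sum_of_copies smul act n \<rho> (span ?C)"
      unfolding sum_of_copies_def by (intro conjI allI ballI inv subspace_span exI[of _ "{V. is_copy smul act n \<rho> V}"] refl) simp_all
  next
    fix W
    assume "subspace W \<and> (\<forall>g. \<forall>x\<in>W. act g x \<in> W) \<and> sum_of_copies smul act n \<rho> W"
    then obtain \<V> where "\<forall>V\<in>\<V>. is_copy smul act n \<rho> V" "W = span (\<Union>\<V>)"
      unfolding sum_of_copies_def by blast
    moreover from this have "\<Union>\<V> \<subseteq> ?C" by blast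
    ultimately show "W \<le> span ?C" using span_mono by simp
  qed
qed

definition finitely_many_isotypic_components ::
    "(complex \<Rightarrow> 'e \<Rightarrow> 'e::ab_group_add) \<Rightarrow>
      ('g::{topological_space, group_add} \<Rightarrow> 'e \<Rightarrow> 'e) \<Rightarrow> bool" where
  "finitely_many_isotypic_components smul act \<longleftrightarrow>
     (\<exists>R. finite R \<and> (\<forall>(n, \<rho>)\<in>R. irreducible_representation n \<rho>) \<and>
       module.span smul (\<Union>(n, \<rho>)\<in>R. isotypic_component smul act n \<rho>) = UNIV)"

definition continuous_dual ::
    "(complex \<Rightarrow> 'e \<Rightarrow> 'e::{ab_group_add, topological_space}) \<Rightarrow> ('e \<Rightarrow> complex) set" where
  "continuous_dual smul = {f. Vector_Spaces.linear smul (*) f \<and> continuous_on UNIV f}"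

definition weak_dual ::
    "(complex \<Rightarrow> 'e \<Rightarrow> 'e::{ab_group_add, topological_space}) \<Rightarrow> ('e \<Rightarrow> complex) topology" where
  "weak_dual smul =
     subtopology (product_topology (\<lambda>x. euclidean) UNIV) (continuous_dual smul)"

definition dual_action ::
    "('g::group_add \<Rightarrow> 'e \<Rightarrow> 'e) \<Rightarrow> 'g \<Rightarrow> ('e \<Rightarrow> complex) \<Rightarrow> ('e \<Rightarrow> complex)" where
  "dual_action act g f = (\<lambda>x. f (act (- g) x))"

end

theory Submission
  imports Defs
begin

text \<open>
  A vector \<open>T v\<close> in a copy of \<open>\<rho>\<close> has an orbit \<open>act g (T v) = T (\<rho> g *\<^sub>v v)\<close> inside a
  finite-dimensional space, with coordinates continuous in \<open>g\<close>. Hence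
  \<open>(g, f) \<mapsto> f (act (- g) (T v))\<close> is a finite sum of products of a continuous function of \<open>g\<close>
  and an evaluation of \<open>f\<close>, so it is jointly continuous. The vectors \<open>x\<close> for which
  \<open>(g, f) \<mapsto> f (act (- g) x)\<close> is jointly continuous form a subspace, so it contains the span
  of all copies, which is \<open>E\<close>.
\<close>

lemma continuous_map_mult:
  fixes f g :: "'a \<Rightarrow> 'b::real_normed_algebra"
  shows "continuous_map X euclidean f \<Longrightarrow> continuous_map X euclidean g \<Longrightarrow>
    continuous_map X euclidean (\<lambda>x. f x * g x)"
  by (simp add: continuous_map_atin tendsto_mult)

text \<open>\<open>carrier_vec n\<close> is a set rather than a type, so \<open>T\<close> is
  additive and homogeneous only on it. Truncations of \<open>v\<close> to its first \<open>k\<close>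
  coordinates gain one basis term at a time, and the truncation at \<open>k = n\<close> is
  \<open>v\<close> itself.\<close>

lemma (in vector_space) linear_on_carrier_vec_expansion:
  fixes T :: "'a Matrix.vec \<Rightarrow> 'b"
  assumes add: "\<And>v w. v \<in> carrier_vec n \<Longrightarrow> w \<in> carrier_vec n \<Longrightarrow> T (v + w) = T v + T w"
    and smult: "\<And>c v. v \<in> carrier_vec n \<Longrightarrow> T (c \<cdot>\<^sub>v v) = scale c (T v)"
    and v: "v \<in> carrier_vec n"
  shows "T v = (\<Sum>i<n. scale (vec_index v i) (T (unit_vec n i)))"
proof -
  have "T (Matrix.vec n (\<lambda>i. if i < k then vec_index v i else 0)) =
      (\<Sum>i<k. scale (vec_index v i) (T (unit_vec n i)))" (is "T (?t k) = _") if "k \<le> n" for k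
    using that
  proof (induction k)
    case 0
    \<comment> \<open>Written as a multiple by the scalar 0, the zero vector is sent to zero by
      homogeneity.\<close>
    have "?t 0 = 0 \<cdot>\<^sub>v 0\<^sub>v n" by auto
    then show ?case using smult[of "0\<^sub>v n" 0] by simp
  next
    case (Suc k)
    have "?t (Suc k) = ?t k + vec_index v k \<cdot>\<^sub>v unit_vec n k"
      using Suc.prems by (intro eq_vecI) (auto simp: less_Suc_eq)
    then show ?case using Suc add[of "?t k"] smult by simp
  qed
  from this[of n] moreover have "Matrix.vec n (\<lambda>i. if i < n then vec_index v i else 0) = v"
    using v by (intro eq_vecI) auto
  ultimately show ?thesis by simp
qed

text \<open>For fixed \<open>v\<close>, each coordinate of the orbit is a linear combination, with
  constant coefficients, of matrix entries of \<rho>.\<close>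

lemma continuous_on_representation_orbit:
  assumes "representation n \<rho>" "v \<in> carrier_vec n" "i < n"
  shows "continuous_on UNIV (\<lambda>g. vec_index (\<rho> g *\<^sub>v v) i)"
proof -
  have "vec_index (\<rho> g *\<^sub>v v) i = (\<Sum>j<n. \<rho> g $$ (i, j) * vec_index v j)" for g
  proof -
    have "\<rho> g \<in> carrier_mat n n" using assms by (auto simp: representation_def)
    then show ?thesis
      using assms by (auto simp: scalar_prod_def atLeast0LessThan intro!: sum.cong)
  qed
  then show ?thesis
    using assms by (auto simp: representation_def intro!: continuous_intros)
qed

lemma continuous_map_weak_dual_eval:
  "continuous_map (weak_dual smul) euclidean (\<lambda>f. f x)"
  unfolding weak_dual_def
  by (intro continuous_map_from_subtopology continuous_map_product_projection) simp

lemma topspace_weak_dual: "topspace (weak_dual smul) = continuous_dual smul"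
  by (simp add: weak_dual_def)

lemma linear_dual_action:
  assumes "linear_action smul act" "Vector_Spaces.linear smul (*) f"
  shows "Vector_Spaces.linear smul (*) (dual_action act g f)"
proof -
  have "Vector_Spaces.linear smul (*) (f \<circ> act (- g))"
    using assms by (intro Vector_Spaces.linear_compose) (auto simp: linear_action_def)
  then show ?thesis by (simp add: dual_action_def comp_def)
qed

lemma dual_action_in_continuous_dual:
  assumes "linear_action smul act" "separately_continuous act" "f \<in> continuous_dual smul"
  shows "dual_action act g f \<in> continuous_dual smul"
proof -
  have "continuous_on UNIV (f \<circ> act (- g))"
    using assms
    by (intro continuous_on_compose)
      (auto simp: separately_continuous_def continuous_dual_def intro: continuous_on_subset)
  then show ?thesis
    using assms linear_dual_action[OF assms(1)]
    by (simp add: continuous_dual_def dual_action_def comp_def)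
qed

context
  fixes smul :: "complex \<Rightarrow> 'e::{ab_group_add, topological_space} \<Rightarrow> 'e"
    and act :: "'g::topological_group_add \<Rightarrow> 'e \<Rightarrow> 'e"
  assumes vs: "vector_space smul"
    and lin: "linear_action smul act"
begin

interpretation E: vector_space smul by (fact vs)

text \<open>The weak dual has the topology of pointwise convergence, so for a separately continuous
  action the dual action is jointly continuous exactly when this set is the whole space.\<close>

definition jointly_continuous_vectors :: "'e set" where
  "jointly_continuous_vectors =
    {x. continuous_map (prod_topology euclidean (weak_dual smul)) euclidean
      (\<lambda>p. dual_action act (fst p) (snd p) x)}"

lemma subspace_jointly_continuous_vectors: "E.subspace jointly_continuous_vectors"
proof (rule E.subspaceI)
  let ?X = "prod_topology (euclidean :: 'g topology) (weak_dual smul)"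
  \<comment> \<open>The type of \<open>f\<close> admits arbitrary functions; linearity holds only on
    the topspace. This is enough, since \<open>continuous_map_eq\<close> compares two maps only
    there.\<close>
  have "Vector_Spaces.linear smul (*) (dual_action act g f)" if "(g, f) \<in> topspace ?X" for g f
    using that linear_dual_action[OF lin]
    by (simp add: topspace_weak_dual continuous_dual_def)
  then have hom: "module_hom smul (*) (dual_action act g f)" if "(g, f) \<in> topspace ?X" for g f
    using that by (blast intro: Vector_Spaces.linear.axioms)
  note zero = module_hom.zero[OF hom] and add = module_hom.add[OF hom]
    and scale = module_hom.scale[OF hom]
  show "0 \<in> jointly_continuous_vectors"
    unfolding jointly_continuous_vectors_def mem_Collect_eq
    by (rule continuous_map_eq[where f = "\<lambda>_. 0"]) (use zero in auto)
  show "x + y \<in> jointly_continuous_vectors"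
    if "x \<in> jointly_continuous_vectors" "y \<in> jointly_continuous_vectors" for x y
    unfolding jointly_continuous_vectors_def mem_Collect_eq
    by (rule continuous_map_eq[OF continuous_map_add[OF
            that[unfolded jointly_continuous_vectors_def mem_Collect_eq]]])
      (auto simp: add)
  show "smul c x \<in> jointly_continuous_vectors" if "x \<in> jointly_continuous_vectors" for c x
    unfolding jointly_continuous_vectors_def mem_Collect_eq
    by (rule continuous_map_eq[OF continuous_map_mult[where f = "\<lambda>_. c",
            OF _ that[unfolded jointly_continuous_vectors_def mem_Collect_eq]]])
      (auto simp: scale)
qed

lemma copy_subset_jointly_continuous_vectors:
  assumes \<rho>: "representation n \<rho>" and copy: "is_copy smul act n \<rho> V"
  shows "V \<subseteq> jointly_continuous_vectors"
proof
  fix x assume "x \<in> V"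
  then obtain T v where v: "v \<in> carrier_vec n" "x = T v"
    and add: "\<And>v w. v \<in> carrier_vec n \<Longrightarrow> w \<in> carrier_vec n \<Longrightarrow> T (v + w) = T v + T w"
    and smult: "\<And>c v. v \<in> carrier_vec n \<Longrightarrow> T (c \<cdot>\<^sub>v v) = smul c (T v)"
    and equiv: "\<And>g v. v \<in> carrier_vec n \<Longrightarrow> T (\<rho> g *\<^sub>v v) = act g (T v)"
    using copy unfolding is_copy_def bij_betw_def by blast
  let ?X = "prod_topology (euclidean :: 'g topology) (weak_dual smul)"
  let ?e = "\<lambda>i. T (unit_vec n i)" and ?a = "\<lambda>i g. vec_index (\<rho> g *\<^sub>v v) i"
  \<comment> \<open>The vectors \<open>?e i\<close> are independent of \<open>g\<close>, so all
    dependence on \<open>g\<close> lies in the scalar coefficients.\<close>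
  have orbit: "act g x = (\<Sum>i<n. smul (?a i g) (?e i))" for g
  proof -
    have "\<rho> g *\<^sub>v v \<in> carrier_vec n"
      using \<rho> v by (auto simp: representation_def intro: mult_mat_vec_carrier)
    from E.linear_on_carrier_vec_expansion[of n T, OF add smult this]
    show ?thesis using equiv v by simp
  qed
  \<comment> \<open>This is the functional \<open>snd p\<close> applied to the orbit formula at
    \<open>- fst p\<close>, the inverse coming from the dual action. Each factor depends on one
    component of \<open>p\<close> alone.\<close>
  have "continuous_map ?X euclidean (\<lambda>p. \<Sum>i<n. ?a i (- fst p) * snd p (?e i))"
  proof (intro continuous_map_sum continuous_map_mult)
    fix i assume "i \<in> {..<n}"
    then have "continuous_on UNIV (\<lambda>g. ?a i (- g))"
      using \<rho> v
      by (intro continuous_on_compose2[OF continuous_on_representation_orbit])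
        (auto intro!: continuous_intros)
    then have "continuous_map euclidean euclidean (\<lambda>g. ?a i (- g))" by simp
    from continuous_map_compose[OF continuous_map_fst this]
    show "continuous_map ?X euclidean (\<lambda>p. ?a i (- fst p))" by (simp add: comp_def)
    show "continuous_map ?X euclidean (\<lambda>p. snd p (?e i))"
      using continuous_map_compose[OF continuous_map_snd continuous_map_weak_dual_eval]
      by (simp add: comp_def)
  qed simp
  moreover have "(\<Sum>i<n. ?a i (- fst p) * snd p (?e i)) = dual_action act (fst p) (snd p) x"
    if "p \<in> topspace ?X" for p
  proof -
    have "Vector_Spaces.linear smul (*) (snd p)"
      using that by (auto simp: topspace_weak_dual continuous_dual_def)
    then interpret f: Vector_Spaces.linear smul "(*)" "snd p" .
    show ?thesis by (simp add: dual_action_def orbit f.sum f.scale)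
  qed
  ultimately show "x \<in> jointly_continuous_vectors"
    unfolding jointly_continuous_vectors_def mem_Collect_eq by (rule continuous_map_eq)
qed

lemma isotypic_component_subset_jointly_continuous_vectors:
  assumes \<rho>: "representation n \<rho>"
  shows "isotypic_component smul act n \<rho> \<subseteq> jointly_continuous_vectors"
proof -
  have "isotypic_component smul act n \<rho> = E.span (\<Union>{V. is_copy smul act n \<rho> V})"
    using \<rho> by (intro isotypic_component_eq_span vs lin) (simp add: representation_def)
  also have "\<dots> \<subseteq> jointly_continuous_vectors"
    using copy_subset_jointly_continuous_vectors[OF \<rho>]
    by (intro E.span_minimal subspace_jointly_continuous_vectors) blast
  finally show ?thesis .
qed

end

theorem lemma2p4:
  fixes smul :: "complex \<Rightarrow> 'e \<Rightarrow> 'e::{topological_ab_group_add, t2_space}"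
    and act :: "'g::{topological_group_add, t2_space} \<Rightarrow> 'e \<Rightarrow> 'e"
  assumes "locally_convex_space smul"
    and "compact (UNIV :: 'g set)"
    and "linear_action smul act"
    and "separately_continuous act"
    and "finitely_many_isotypic_components smul act"
  shows "jointly_continuous euclidean (weak_dual smul) (dual_action act)"
proof -
  interpret E: locally_convex_space smul by fact
  have vs: "vector_space smul" by unfold_locales
  obtain R where R: "\<And>n \<rho>. (n, \<rho>) \<in> R \<Longrightarrow> irreducible_representation n \<rho>"
    and span: "E.span (\<Union>(n, \<rho>)\<in>R. isotypic_component smul act n \<rho>) = UNIV"
    using assms(5) unfolding finitely_many_isotypic_components_def by blast
  have "E.span (\<Union>(n, \<rho>)\<in>R. isotypic_component smul act n \<rho>) \<subseteq> jointly_continuous_vectors smul act"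
    using isotypic_component_subset_jointly_continuous_vectors[OF vs assms(3)] R
    by (intro E.span_minimal subspace_jointly_continuous_vectors[OF vs assms(3)])
      (fastforce simp: irreducible_representation_def)
  then have "x \<in> jointly_continuous_vectors smul act" for x
    using span by blast
  then have "continuous_map (prod_topology euclidean (weak_dual smul))
      (product_topology (\<lambda>x. euclidean) UNIV) (\<lambda>(g, f). dual_action act g f)"
    by (simp add: continuous_map_componentwise_UNIV case_prod_beta
        jointly_continuous_vectors_def[OF vs assms(3)])
  \<comment> \<open>Continuity so far is into the space of all functions. To land in the subspace
    \<open>weak_dual smul\<close>, each translated functional must be continuous, which follows from
    the continuity of every \<open>act g\<close>.\<close>
  moreover have "(\<lambda>(g, f). dual_action act g f) \<in>
      topspace (prod_topology euclidean (weak_dual smul)) \<rightarrow> continuous_dual smul"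
    using dual_action_in_continuous_dual[OF assms(3,4)] by (auto simp: topspace_weak_dual)
  ultimately show ?thesis
    \<comment> \<open>The second occurrence of \<open>weak_dual\<close> is the codomain; the one in
      the domain stays folded.\<close>
    unfolding jointly_continuous_def by (subst (2) weak_dual_def) (simp add: continuous_map_in_subtopology)
qed

end
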